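(* Let $n$ be a non-zero integer. For any virtual knot $K$, the coefficient of $t^n$ in the affine index polynomial $P_K(t)$ is the $(-n)$-writhe $J_{-n}(K)$.
   Context: A virtual knot diagram is an immersed oriented loop in $\mathbb{R}^2$ whose multiple points are transverse double points, each of which is either a classical crossing (with over/under information, and with a sign ${\rm sgn}(c)\in\{+1,-1\}$ as usual in knot theory) or a virtual crossing (without over/under information). Generalized Reidemeister moves are the classical Reidemeister moves I, II, III and the virtual Reidemeister moves: the analogues of I, II, III in which all crossings are virtual, and the mixed move IV in which an arc with two virtual crossings is moved across a classical crossing. A virtual knot is an equivalence class of virtual knot diagrams under generalized Reidemeister moves and isotopies of $\mathbb{R}^2$. $X(D)$ denotes the set of classical crossings of $D$. For $c\in X(D)$ let $D_c$ be the two-component diagram obtained by smoothing $D$ at $c$ respecting the orientation. Its components near $c$ lie one to the left and one to the right with respect to the orientation of the strands at $c$; they are denoted $D_c^{\rm L}$ and $D_c^{\rm R}$. Put $D_c^{\rm O}=D_c^{\rm R}$, $D_c^{\rm U}=D_c^{\rm L}$ if ${\rm sgn}(c)=+1$, and $D_c^{\rm O}=D_c^{\rm L}$, $D_c^{\rm U}=D_c^{\rm R}$ if ${\rm sgn}(c)=-1$. (Equivalently, $D_c^{\rm O}$ leaves $c$ along the outgoing over strand and returns along the incoming under strand, and $D_c^{\rm U}$ leaves along the outgoing under strand and returns along the incoming over strand.) For $\ast\in\{{\rm L},{\rm R},{\rm O},{\rm U}\}$ let $\gamma_1,\dots,\gamma_k$ be the sequence of classical crossings of $D$ met when travelling once along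 $D_c^\ast$ from a point near $c$ back to that point ($c$ itself is not included; a self-crossing of $D_c^\ast$ appears twice). The flat sign $\iota(\gamma_i,D_c^\ast)$ is ${\rm sgn}(\gamma_i)$ if $\gamma_i$ is passed as an under crossing and $-{\rm sgn}(\gamma_i)$ if passed as an over crossing. Put ${\rm ind}^\ast(c,D)=\sum_i\iota(\gamma_i,D_c^\ast)$. The Satoh--Taniguchi index is ${\rm Ind}^{\rm ST}(c)={\rm ind}^{\rm O}(c,D)$, and for $n\neq0$ the $n$-writhe is $J_n(D)=\sum_{c\in X(D):\ {\rm Ind}^{\rm ST}(c)=n}{\rm sgn}(c)$. Kauffman's weight is $W_D(c)=W_{{\rm sgn}(c)}(c)$, where $W_+(c)={\rm ind}^{\rm L}(c,D)$ and $W_-(c)={\rm ind}^{\rm R}(c,D)$; thus $W_D(c)={\rm ind}^{\rm U}(c,D)$. The affine index polynomial is $P_D(t)=\sum_{c\in X(D)}{\rm sgn}(c)(t^{W_D(c)}-1)$. Both $J_n(D)$ $(n\ne0)$ and $P_D(t)$ are known to depend only on the virtual knot $K$ represented by $D$, and $J_n(K):=J_n(D)$, $P_K(t):=P_D(t)$. *)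

theory Defs
  imports "HOL-Analysis.Analysis" "HOL-Library.Poly_Mapping"
begin

section \<open>Virtual knot diagrams\<close>

text \<open>
  The loop is parametrised by \<open>\<real>/\<int>\<close>, i.e. by a 1-periodic function, and the plane is the
  type of complex numbers.  A double point is the pair of its parameters in \<open>[0,1)\<close>.
  A classical crossing is the ordered pair (over parameter, under parameter); a double point
  none of whose orderings belongs to \<open>xings\<close> is a virtual crossing.
\<close>

record vdiagram =
  curve :: "real \<Rightarrow> complex"
  xings :: "(real \<times> real) set"

definition velocity :: "vdiagram \<Rightarrow> real \<Rightarrow> complex" where
  "velocity D t = vector_derivative (curve D) (at t)"

text \<open>\<open>orient v w > 0\<close> iff \<open>(v, w)\<close> is a positively oriented basis of the plane.\<close>

definition orient :: "complex \<Rightarrow> complex \<Rightarrow> real" where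
  "orient v w = Re v * Im w - Im v * Re w"

definition double_points :: "(real \<Rightarrow> complex) \<Rightarrow> (real \<times> real) set" where
  "double_points \<gamma> = {(s, t). s \<in> {0..<1} \<and> t \<in> {0..<1} \<and> s \<noteq> t \<and> \<gamma> s = \<gamma> t}"

text \<open>
  Finiteness of the set of double points follows from the other clauses by compactness; it is
  stated for convenience.
\<close>

definition virtual_diagram :: "vdiagram \<Rightarrow> bool" where
  "virtual_diagram D \<longleftrightarrow>
     (\<forall>t. curve D (t + 1) = curve D t) \<and>
     curve D C1_differentiable_on UNIV \<and>
     (\<forall>t. velocity D t \<noteq> 0) \<and>
     finite (double_points (curve D)) \<and>
     (\<forall>(s, t) \<in> double_points (curve D). orient (velocity D s) (velocity D t) \<noteq> 0) \<and>
     (\<forall>s t u. (s, t) \<in> double_points (curve D) \<and> (s, u) \<in> double_points (curve D) \<longrightarrow> t = u) \<and>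
     xings D \<subseteq> double_points (curve D) \<and>
     (\<forall>(s, t) \<in> xings D. (t, s) \<notin> xings D)"

text \<open>
  A crossing is positive iff a counterclockwise turn by less than \<open>\<pi>\<close> takes the over
  direction to the under direction.
\<close>

definition xsgn :: "vdiagram \<Rightarrow> real \<times> real \<Rightarrow> int" where
  "xsgn D c = (if orient (velocity D (fst c)) (velocity D (snd c)) > 0 then 1 else -1)"


section \<open>Equivalence of diagrams\<close>

text \<open>
  Ambient isotopy of the plane, combined with an orientation preserving change of parameter
  of the loop.
\<close>

definition plane_isotopy :: "(real \<Rightarrow> complex \<Rightarrow> complex) \<Rightarrow> bool" where
  "plane_isotopy H \<longleftrightarrow>
     continuous_on ({0..1} \<times> UNIV) (\<lambda>(s, z). H s z) \<and>
     (\<forall>s \<in> {0..1}. \<exists>G. homeomorphism UNIV UNIV (H s) G) \<and>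
     H 0 = id"

definition reparametrisation :: "(real \<Rightarrow> real) \<Rightarrow> bool" where
  "reparametrisation \<phi> \<longleftrightarrow>
     continuous_on UNIV \<phi> \<and> strict_mono \<phi> \<and> (\<forall>t. \<phi> (t + 1) = \<phi> t + 1)"

definition isotopic :: "vdiagram \<Rightarrow> vdiagram \<Rightarrow> bool" where
  "isotopic D E \<longleftrightarrow>
     (\<exists>H \<phi>. plane_isotopy H \<and> reparametrisation \<phi> \<and>
        (\<forall>t. curve E (\<phi> t) = H 1 (curve D t)) \<and>
        xings E = (\<lambda>(s, t). (frac (\<phi> s), frac (\<phi> t))) ` xings D)"

text \<open>
  \<open>local_change D E \<A>\<close>: the diagrams \<open>D\<close> and \<open>E\<close> coincide outside an open round disc, and
  their parts inside the disc are the strands parametrised by the open intervals in \<open>\<A>\<close>.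
  Up to isotopy and change of parameter, the disc of a generalized Reidemeister move is round,
  \<open>D\<close> and \<open>E\<close> have the same parametrisation outside the disc, and the
  parameter 0 is not on a strand inside the disc.
\<close>

definition local_change :: "vdiagram \<Rightarrow> vdiagram \<Rightarrow> real set set \<Rightarrow> bool" where
  "local_change D E \<A> \<longleftrightarrow>
     (\<forall>A \<in> \<A>. \<exists>a b. 0 < a \<and> a < b \<and> b < 1 \<and> A = {a<..<b}) \<and>
     pairwise (\<lambda>A B. closure A \<inter> closure B = {}) \<A> \<and>
     (\<exists>z r. r > 0 \<and>
        (\<forall>t \<in> \<Union>\<A>. curve D t \<in> ball z r \<and> curve E t \<in> ball z r) \<and>
        (\<forall>t \<in> {0..<1} - \<Union>\<A>. curve D t = curve E t \<and> curve D t \<notin> ball z r) \<and>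
        (\<forall>(s, t) \<in> double_points (curve D). curve D s \<notin> sphere z r)) \<and>
     (\<forall>s t. s \<notin> \<Union>\<A> \<and> t \<notin> \<Union>\<A> \<longrightarrow> ((s, t) \<in> xings D \<longleftrightarrow> (s, t) \<in> xings E))"

definition meets :: "vdiagram \<Rightarrow> real set \<Rightarrow> real set \<Rightarrow> (real \<times> real) set" where
  "meets D A B = {(s, t). s \<in> A \<and> t \<in> B \<and> curve D s = curve D t}"

definition is_virtual :: "vdiagram \<Rightarrow> real \<times> real \<Rightarrow> bool" where
  "is_virtual D p \<longleftrightarrow> p \<notin> xings D \<and> prod.swap p \<notin> xings D"

text \<open>
  Same type: both virtual, or both classical with the first strand over at both, or both
  classical with the first strand under at both.
\<close>

definition same_type :: "vdiagram \<Rightarrow> real \<times> real \<Rightarrow> vdiagram \<Rightarrow> real \<times> real \<Rightarrow> bool" where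
  "same_type D p E q \<longleftrightarrow>
     (p \<in> xings D \<longleftrightarrow> q \<in> xings E) \<and> (prod.swap p \<in> xings D \<longleftrightarrow> prod.swap q \<in> xings E)"

text \<open>
  The moves are described by how the strands cross inside the disc, which determines the
  pictures up to an isotopy of the disc fixing its boundary.

  I: a strand with one self-crossing (classical or virtual) is replaced by an embedded one.
\<close>

definition move_I :: "vdiagram \<Rightarrow> vdiagram \<Rightarrow> bool" where
  "move_I D E \<longleftrightarrow>
     (\<exists>A s t. local_change D E {A} \<and>
        {(x, y) \<in> meets D A A. x < y} = {(s, t)} \<and> inj_on (curve E) A)"

text \<open>
  II: two embedded strands crossing twice, at crossings of the same type, are replaced by
  disjoint ones.
\<close>

definition move_II :: "vdiagram \<Rightarrow> vdiagram \<Rightarrow> bool" where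
  "move_II D E \<longleftrightarrow>
     (\<exists>A B p q. A \<noteq> B \<and> local_change D E {A, B} \<and>
        inj_on (curve D) A \<and> inj_on (curve D) B \<and>
        p \<noteq> q \<and> meets D A B = {p, q} \<and> same_type D p D q \<and>
        inj_on (curve E) A \<and> inj_on (curve E) B \<and> meets E A B = {})"

text \<open>
  III and IV: three embedded strands, any two of which cross once.  With the endpoints
  fixed, there are two such configurations up to isotopy, interchanged by moving
  one strand across the crossing of the other two; the types of the three crossings are kept.
  Either \<open>A\<close> is over \<open>B\<close> and \<open>C\<close>, and \<open>B\<close> is over \<open>C\<close> (classical III), or \<open>A\<close> meets \<open>B\<close> and
  \<open>C\<close> in virtual crossings, and the crossing of \<open>B\<close> and \<open>C\<close> is arbitrary: virtual
  (virtual III) or classical (IV).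
\<close>

definition move_III_IV :: "vdiagram \<Rightarrow> vdiagram \<Rightarrow> bool" where
  "move_III_IV D E \<longleftrightarrow>
     (\<exists>A B C p q r p' q' r'.
        A \<noteq> B \<and> A \<noteq> C \<and> B \<noteq> C \<and> local_change D E {A, B, C} \<and>
        (\<forall>S \<in> {A, B, C}. inj_on (curve D) S \<and> inj_on (curve E) S) \<and>
        meets D A B = {p} \<and> meets D A C = {q} \<and> meets D B C = {r} \<and>
        meets E A B = {p'} \<and> meets E A C = {q'} \<and> meets E B C = {r'} \<and>
        same_type D p E p' \<and> same_type D q E q' \<and> same_type D r E r' \<and>
        (p \<in> xings D \<and> q \<in> xings D \<and> r \<in> xings D \<or> is_virtual D p \<and> is_virtual D q))"

definition knot_step :: "vdiagram \<Rightarrow> vdiagram \<Rightarrow> bool" where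
  "knot_step D E \<longleftrightarrow> virtual_diagram D \<and> virtual_diagram E \<and>
     (isotopic D E \<or> move_I D E \<or> move_II D E \<or> move_III_IV D E)"

definition virtual_knots :: "vdiagram set set" where
  "virtual_knots =
     Collect virtual_diagram //
       {(D, E). virtual_diagram D \<and> virtual_diagram E \<and> equivclp knot_step D E}"


section \<open>Smoothings and indices\<close>

text \<open>
  A component of the diagram smoothed at \<open>c\<close> is given by the parameters (start, end) of the
  part of the loop that it traverses: it leaves \<open>c\<close> at the first one and returns at the second.
  If the under direction is to the left of the over direction, then the left component leaves
  along the under strand and returns along the over strand; otherwise it leaves along the over
  strand and returns along the under strand.
\<close>

datatype component = Lft | Rgt | Ovr | Und

definition left_part :: "vdiagram \<Rightarrow> real \<times> real \<Rightarrow> real \<times> real" where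
  "left_part D c =
     (if orient (velocity D (fst c)) (velocity D (snd c)) > 0 then (snd c, fst c)
      else (fst c, snd c))"

definition right_part :: "vdiagram \<Rightarrow> real \<times> real \<Rightarrow> real \<times> real" where
  "right_part D c = prod.swap (left_part D c)"

fun smoothing :: "vdiagram \<Rightarrow> real \<times> real \<Rightarrow> component \<Rightarrow> real \<times> real" where
  "smoothing D c Lft = left_part D c"
| "smoothing D c Rgt = right_part D c"
| "smoothing D c Ovr = (if xsgn D c = 1 then right_part D c else left_part D c)"
| "smoothing D c Und = (if xsgn D c = 1 then left_part D c else right_part D c)"

lemma smoothing_Ovr: "smoothing D c Ovr = (fst c, snd c)"
  and smoothing_Und: "smoothing D c Und = (snd c, fst c)"
  by (cases c; simp add: xsgn_def left_part_def right_part_def)+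

text \<open>The open arc of the circle \<open>\<real>/\<int>\<close> from \<open>s\<close> to \<open>t\<close> in the positive direction.\<close>

definition circle_arc :: "real \<Rightarrow> real \<Rightarrow> real set" where
  "circle_arc s t = {x \<in> {0..<1}. 0 < frac (x - s) \<and> frac (x - s) < frac (t - s)}"

text \<open>
  The classical crossings met along a component, each with the parameter at which it is
  passed; a self-crossing of the component occurs with two parameters.
\<close>

definition passages :: "vdiagram \<Rightarrow> real \<times> real \<Rightarrow> ((real \<times> real) \<times> real) set" where
  "passages D p = {(d, x). d \<in> xings D \<and> x \<in> {fst d, snd d} \<and> x \<in> circle_arc (fst p) (snd p)}"

fun flat_sign :: "vdiagram \<Rightarrow> (real \<times> real) \<times> real \<Rightarrow> int" where
  "flat_sign D (d, x) = (if x = snd d then xsgn D d else - xsgn D d)"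

definition ind :: "vdiagram \<Rightarrow> component \<Rightarrow> real \<times> real \<Rightarrow> int" where
  "ind D k c = (\<Sum>g \<in> passages D (smoothing D c k). flat_sign D g)"

definition ind_ST :: "vdiagram \<Rightarrow> real \<times> real \<Rightarrow> int" where
  "ind_ST D c = ind D Ovr c"

definition writhe :: "int \<Rightarrow> vdiagram \<Rightarrow> int" where
  "writhe n D = (\<Sum>c \<in> {c \<in> xings D. ind_ST D c = n}. xsgn D c)"

definition kauffman_weight :: "vdiagram \<Rightarrow> real \<times> real \<Rightarrow> int" where
  "kauffman_weight D c = (if xsgn D c = 1 then ind D Lft c else ind D Rgt c)"

text \<open>
  Integer Laurent polynomials are the finitely supported functions from exponents to
  coefficients, with the convolution product.
\<close>

type_synonym laurent = "int \<Rightarrow>\<^sub>0 int"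

definition t_pow :: "int \<Rightarrow> laurent" where
  "t_pow k = Poly_Mapping.single k 1"

definition affine_index_poly :: "vdiagram \<Rightarrow> laurent" where
  "affine_index_poly D = (\<Sum>c \<in> xings D. of_int (xsgn D c) * (t_pow (kauffman_weight D c) - 1))"

text \<open>
  A diagram invariant evaluated on a virtual knot, via a representative.  It is used only for
  the affine index polynomial and the \<open>n\<close>-writhes with \<open>n \<noteq> 0\<close>, which do not depend on the
  representative.
\<close>

definition on_knot :: "(vdiagram \<Rightarrow> 'a) \<Rightarrow> vdiagram set \<Rightarrow> 'a" where
  "on_knot f K = f (SOME D. D \<in> K)"

end

theory Submission
  imports Defs
begin

text \<open>
  A virtual knot is a nonempty set of diagrams, and the identity holds for each of them separately.
  For a fixed diagram everything rests on the antisymmetry \<open>ind\<^sup>U(c) = - ind\<^sup>O(c)\<close>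
  (\<open>ind_Und_eq_uminus_ind_Ovr\<close>).  The two components of the smoothing at \<open>c\<close> together traverse
  the whole loop except \<open>c\<close>; on the whole loop, every crossing other than \<open>c\<close> is passed once over
  and once under, and these two passages have opposite flat signs.  Hence the two indices sum to 0.
  Kauffman's weight is \<open>ind\<^sup>U\<close> and the Satoh--Taniguchi index is \<open>ind\<^sup>O\<close>, so the
  crossings of weight \<open>n\<close> are those of index \<open>-n\<close>.  The terms \<open>-1\<close> in the affine index
  polynomial only affect the constant coefficient, so for \<open>n \<noteq> 0\<close> the coefficient of \<open>t\<^sup>n\<close>
  adds up the signs of exactly these crossings.
\<close>

lemma frac_diff_unit_interval:
  fixes a b :: real
  assumes "a \<in> {0..<1}" "b \<in> {0..<1}"
  shows "frac (a - b) = (if b \<le> a then a - b else a - b + 1)"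
proof (cases "b \<le> a")
  case True
  with assms have "frac (a - b) = a - b" by (subst frac_eq) auto
  with True show ?thesis by simp
next
  case False
  have "frac (a - b) = frac (a - b + 1)" by (simp add: frac_def)
  also from False assms have "\<dots> = a - b + 1" by (subst frac_eq) auto
  finally show ?thesis using False by simp
qed

lemma mem_circle_arc_iff:
  assumes "s \<in> {0..<1}" "t \<in> {0..<1}" "s \<noteq> t"
  shows "x \<in> circle_arc s t \<longleftrightarrow>
           x \<in> {0..<1} \<and> (if s < t then s < x \<and> x < t else s < x \<or> x < t)"
proof (cases "x \<in> {0..<1}")
  case True
  with assms show ?thesis
    by (auto simp: circle_arc_def frac_diff_unit_interval simp del: frac_gt_0_iff)
qed (auto simp: circle_arc_def)

lemma circle_arc_Un_swap:
  assumes "s \<in> {0..<1}" "t \<in> {0..<1}" "s \<noteq> t"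
  shows "circle_arc s t \<union> circle_arc t s = {0..<1} - {s, t}"
  using assms by (auto simp: mem_circle_arc_iff split: if_splits)

lemma circle_arc_Int_swap:
  assumes "s \<in> {0..<1}" "t \<in> {0..<1}" "s \<noteq> t"
  shows "circle_arc s t \<inter> circle_arc t s = {}"
  using assms by (auto simp: mem_circle_arc_iff split: if_splits)

lemma virtual_diagramD:
  assumes "virtual_diagram D"
  shows finite_xings: "finite (xings D)"
    and xings_params: "(s, t) \<in> xings D \<Longrightarrow> s \<in> {0..<1} \<and> t \<in> {0..<1} \<and> s \<noteq> t"
proof -
  have sub: "xings D \<subseteq> double_points (curve D)" and "finite (double_points (curve D))"
    using assms by (simp_all add: virtual_diagram_def)
  then show "finite (xings D)" by (rule finite_subset)
  show "(s, t) \<in> xings D \<Longrightarrow> s \<in> {0..<1} \<and> t \<in> {0..<1} \<and> s \<noteq> t"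
    using sub by (auto simp: double_points_def)
qed

text \<open>
  There are no triple points, so a parameter determines the double point that it lies on; and a
  double point is a crossing for at most one of the two orderings of its parameters.
\<close>

lemma xings_eq_if_common_param:
  assumes D: "virtual_diagram D" and c: "c \<in> xings D" and d: "d \<in> xings D"
    and x: "x \<in> {fst c, snd c}" "x \<in> {fst d, snd d}"
  shows "c = d"
proof -
  have sub: "xings D \<subseteq> double_points (curve D)"
    and uniq: "\<And>s t u. (s, t) \<in> double_points (curve D) \<Longrightarrow>
                 (s, u) \<in> double_points (curve D) \<Longrightarrow> t = u"
    and asym: "\<And>s t. (s, t) \<in> xings D \<Longrightarrow> (t, s) \<notin> xings D"
    using D unfolding virtual_diagram_def by blast+
  have swap: "(t, s) \<in> double_points (curve D)" if "(s, t) \<in> double_points (curve D)" for s t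
    using that by (auto simp: double_points_def)
  obtain s t where c_eq: "c = (s, t)" by force
  obtain u v where d_eq: "d = (u, v)" by force
  have cp: "(s, t) \<in> double_points (curve D)" "(t, s) \<in> double_points (curve D)"
    and dp: "(u, v) \<in> double_points (curve D)" "(v, u) \<in> double_points (curve D)"
    using c d sub swap by (auto simp: c_eq d_eq)
  from x consider "s = u" | "s = v" | "t = u" | "t = v" by (auto simp: c_eq d_eq)
  then show ?thesis
  proof cases
    case 1 with uniq[OF cp(1)] dp show ?thesis by (simp add: c_eq d_eq)
  next
    case 2 with uniq[OF cp(1)] dp asym c d show ?thesis by (auto simp: c_eq d_eq)
  next
    case 3 with uniq[OF cp(2)] dp asym c d show ?thesis by (auto simp: c_eq d_eq)
  next
    case 4 with uniq[OF cp(2)] dp show ?thesis by (simp add: c_eq d_eq)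
  qed
qed

text \<open>
  The passages on the two components are those on the whole loop, without the two at \<open>c\<close> itself;
  no passage of another crossing is lost, since no other crossing shares a parameter with \<open>c\<close>.
\<close>

lemma passages_Un_swap:
  assumes D: "virtual_diagram D" and c: "(s, t) \<in> xings D"
  shows "passages D (s, t) \<union> passages D (t, s) =
           (SIGMA d : xings D - {(s, t)}. {fst d, snd d})"
proof -
  note st = xings_params[OF D c]
  have *: "x \<in> circle_arc s t \<or> x \<in> circle_arc t s \<longleftrightarrow> d \<noteq> (s, t)"
    if d: "d \<in> xings D" "x \<in> {fst d, snd d}" for d x
  proof -
    have "x \<in> {0..<1}" using xings_params[OF D, of "fst d" "snd d"] d by auto
    moreover have "x \<in> {s, t} \<longleftrightarrow> d = (s, t)"
      using xings_eq_if_common_param[OF D c d(1), of x] d(2) by auto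
    ultimately show ?thesis using circle_arc_Un_swap[of s t] st by blast
  qed
  show ?thesis
  proof (rule set_eqI)
    fix g :: "(real \<times> real) \<times> real"
    obtain d x where g: "g = (d, x)" by (cases g)
    show "g \<in> passages D (s, t) \<union> passages D (t, s) \<longleftrightarrow>
            g \<in> (SIGMA d : xings D - {(s, t)}. {fst d, snd d})"
      using *[of d x] by (simp add: g passages_def) blast
  qed
qed

lemma ind_Und_eq_uminus_ind_Ovr:
  assumes D: "virtual_diagram D" and c: "c \<in> xings D"
  shows "ind D Und c = - ind D Ovr c"
proof -
  obtain s t where c_eq: "c = (s, t)" by force
  have st: "(s, t) \<in> xings D" using c by (simp add: c_eq)
  let ?P = "SIGMA d : xings D - {(s, t)}. {fst d, snd d}"
  have Un: "passages D (s, t) \<union> passages D (t, s) = ?P"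
    by (rule passages_Un_swap[OF D st])
  have "finite ?P" using finite_xings[OF D] by auto
  then have fin: "finite (passages D (s, t))" "finite (passages D (t, s))"
    unfolding Un[symmetric] by auto
  have disj: "passages D (s, t) \<inter> passages D (t, s) = {}"
    using circle_arc_Int_swap[of s t] xings_params[OF D st] by (auto simp: passages_def)
  have "ind D Ovr c + ind D Und c =
          sum (flat_sign D) (passages D (s, t)) + sum (flat_sign D) (passages D (t, s))"
    unfolding ind_def smoothing_Ovr smoothing_Und by (simp add: c_eq)
  also have "\<dots> = sum (flat_sign D) ?P"
    using sum.union_disjoint[OF fin disj, of "flat_sign D"] by (simp add: Un)
  also have "\<dots> = (\<Sum>d \<in> xings D - {(s, t)}. \<Sum>x \<in> {fst d, snd d}. flat_sign D (d, x))"
    using finite_xings[OF D] by (subst sum.Sigma) (auto simp del: flat_sign.simps)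
  also have "\<dots> = 0"
  proof (rule sum.neutral, rule ballI)
    fix d assume "d \<in> xings D - {(s, t)}"
    then have "fst d \<noteq> snd d" using xings_params[OF D, of "fst d" "snd d"] by auto
    then show "(\<Sum>x \<in> {fst d, snd d}. flat_sign D (d, x)) = 0" by simp
  qed
  finally show ?thesis by simp
qed

lemma kauffman_weight_eq_ind_Und: "kauffman_weight D c = ind D Und c"
  by (simp add: kauffman_weight_def ind_def)

lemma lookup_of_int_mult:
  fixes p :: laurent
  shows "Poly_Mapping.lookup (of_int a * p) n = a * Poly_Mapping.lookup p n"
proof -
  have "Poly_Mapping.lookup (of_nat m * p) n = of_nat m * Poly_Mapping.lookup p n" for m
    by (induction m) (simp_all add: lookup_add algebra_simps)
  then show ?thesis
    by (cases a rule: int_cases2) simp_all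
qed

lemma lookup_affine_index_poly:
  assumes D: "virtual_diagram D" and n: "n \<noteq> 0"
  shows "Poly_Mapping.lookup (affine_index_poly D) n =
           (\<Sum>c \<in> {c \<in> xings D. kauffman_weight D c = n}. xsgn D c)"
proof -
  have "Poly_Mapping.lookup (affine_index_poly D) n =
          (\<Sum>c \<in> xings D. if kauffman_weight D c = n then xsgn D c else 0)"
    unfolding affine_index_poly_def lookup_sum
  proof (rule sum.cong)
    fix c
    show "Poly_Mapping.lookup (of_int (xsgn D c) * (t_pow (kauffman_weight D c) - 1)) n =
            (if kauffman_weight D c = n then xsgn D c else 0)"
      using n by (simp add: lookup_of_int_mult lookup_minus t_pow_def lookup_single lookup_one when_def)
  qed simp
  then show ?thesis
    using finite_xings[OF D] by (simp add: sum.inter_filter)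
qed

lemma lookup_affine_index_poly_eq_writhe:
  assumes D: "virtual_diagram D" and n: "n \<noteq> 0"
  shows "Poly_Mapping.lookup (affine_index_poly D) n = writhe (- n) D"
proof -
  have "{c \<in> xings D. kauffman_weight D c = n} = {c \<in> xings D. ind_ST D c = - n}"
    using ind_Und_eq_uminus_ind_Ovr[OF D] by (auto simp: kauffman_weight_eq_ind_Und ind_ST_def)
  then show ?thesis
    by (simp add: lookup_affine_index_poly[OF D n] writhe_def)
qed

theorem proposition5:
  fixes K :: "vdiagram set" and n :: int
  assumes "K \<in> virtual_knots" and "n \<noteq> 0"
  shows "Poly_Mapping.lookup (on_knot affine_index_poly K) n = on_knot (writhe (- n)) K \<and>
         (\<forall>D \<in> K. Poly_Mapping.lookup (affine_index_poly D) n = writhe (- n) D)"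
proof -
  obtain D\<^sub>0 where "virtual_diagram D\<^sub>0"
    and K: "K = {E. virtual_diagram E \<and> equivclp knot_step D\<^sub>0 E}"
    using assms(1) by (auto simp: virtual_knots_def quotient_def)
  then have "D\<^sub>0 \<in> K" by simp
  \<comment> \<open>The representative chosen by \<open>on_knot\<close> is a diagram because the class is nonempty.\<close>
  then have "(SOME D. D \<in> K) \<in> K" by (rule someI)
  moreover have "\<forall>D \<in> K. Poly_Mapping.lookup (affine_index_poly D) n = writhe (- n) D"
    using lookup_affine_index_poly_eq_writhe[OF _ assms(2)] by (simp add: K)
  ultimately show ?thesis
    unfolding on_knot_def by blast
qed

end
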